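(* Let $\mathcal I$ be an ideal on $\mathbb N$ with the property that there exists an uncountable family $\mathcal A\subset \wp(\mathbb N)\setminus \mathcal I$ such that $A\cap B\in\mathcal I$ for all distinct $A,B\in\mathcal A$. Then the quotient Banach space $\ell_\infty/c_{0,\mathcal I}$ is not isomorphic to a subspace of $\ell_\infty$. In particular, $c_{0,\mathcal I}$ is not complemented in $\ell_\infty$.
   Context: $\wp(\mathbb N)$ denotes the power set of $\mathbb N$. A family $\mathcal I$ of subsets of $\mathbb N$ is an ideal on $\mathbb N$ when it is closed under finite unions and $B\in\mathcal I$ whenever $B\subseteq A$ and $A\in\mathcal I$. $\ell_\infty$ is the Banach space of all bounded scalar sequences (indexed by $\mathbb N$) with the supremum norm. A scalar sequence $(x_n)_{n=1}^\infty$ converges to $0$ along $\mathcal I$ if for every $\varepsilon>0$ there is $A\in\mathcal I$ such that $|x_n|<\varepsilon$ for every $n\notin A$. $c_{0,\mathcal I}$ is the closed subspace of $\ell_\infty$ consisting of all bounded sequences that converge to $0$ along $\mathcal I$; $\ell_\infty/c_{0,\mathcal I}$ carries the quotient norm. "Isomorphic" is in the sense of Banach spaces: being isomorphic to a subspace of $\ell_\infty$ means that there is a linear homeomorphism onto a (closed) linear subspace of $\ell_\infty$ (not necessarily isometric). A closed subspace $E$ of a Banach space $X$ is complemented in $X$ if there exists a closed subspace $F$ of $X$ such that $X=E\oplus F$. *)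

theory Defs
  imports "HOL-Analysis.Analysis"
begin

definition set_ideal :: "nat set set \<Rightarrow> bool" where
  "set_ideal I \<longleftrightarrow>
     (\<forall>F. finite F \<and> F \<subseteq> I \<longrightarrow> \<Union>F \<in> I) \<and> (\<forall>A\<in>I. \<forall>B. B \<subseteq> A \<longrightarrow> B \<in> I)"

definition null_along :: "nat set set \<Rightarrow> (nat \<Rightarrow> 'k::real_normed_vector) \<Rightarrow> bool" where
  "null_along I x \<longleftrightarrow> (\<forall>\<epsilon>>0. \<exists>A\<in>I. \<forall>n. n \<notin> A \<longrightarrow> norm (x n) < \<epsilon>)"


text \<open>
  Every sequence is continuous on the discrete space \<^typ>\<open>nat\<close>, so the library type
  \<^typ>\<open>nat \<Rightarrow>\<^sub>C 'k\<close>, with its supremum norm, is the space of all bounded sequences.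
  The scalar field is a type \<open>'k::{real_normed_field, banach}\<close>: by the theorem of
  Gelfand and Mazur, the real and the complex numbers are the only such fields.
  The library makes \<^typ>\<open>nat \<Rightarrow>\<^sub>C 'k\<close> a real vector space only, hence the following
  multiplication by scalars from \<open>'k\<close>.
\<close>

type_synonym 'k linf = "nat \<Rightarrow>\<^sub>C 'k"

definition linf_scale :: "'k::real_normed_field \<Rightarrow> 'k linf \<Rightarrow> 'k linf" where
  "linf_scale c x = Bcontfun (\<lambda>n. c * apply_bcontfun x n)"

lemma linf_scale_apply [simp]: "apply_bcontfun (linf_scale c x) n = c * apply_bcontfun x n"
proof -
  have "bounded (range (\<lambda>n. c * apply_bcontfun x n))"
    using bounded_linear_image[OF bounded_apply_bcontfun[of x] bounded_linear_mult_right[of c]]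
    by (simp add: image_image)
  then have "(\<lambda>n. c * apply_bcontfun x n) \<in> bcontfun"
    by (simp add: bcontfun_def)
  then show ?thesis
    by (simp add: linf_scale_def Bcontfun_inverse)
qed

lemma apply_bcontfun_linf_scale: "apply_bcontfun (linf_scale c x) = (\<lambda>n. c * apply_bcontfun x n)"
  by (rule ext) simp

interpretation linf: vector_space linf_scale
  by unfold_locales (auto intro!: bcontfun_eqI simp: algebra_simps)

definition c0_ideal :: "nat set set \<Rightarrow> 'k::real_normed_field linf set" where
  "c0_ideal I = {x. null_along I (apply_bcontfun x)}"


text \<open>
  The quotient by a subspace \<open>M\<close>, as the set of cosets \<open>x +o M\<close>. Cosets are added with the
  elementwise \<open>+\<close> of \<^theory>\<open>HOL-Library.Set_Algebras\<close>. In \<open>quot_scale\<close> the summand \<open>M\<close>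
  matters only for \<open>c = 0\<close>, where the image alone would be \<open>{0}\<close>.
\<close>

definition quot :: "'k::real_normed_field linf set \<Rightarrow> 'k linf set set" where
  "quot M = range (\<lambda>x. x +o M)"

definition quot_scale ::
    "'k::real_normed_field linf set \<Rightarrow> 'k \<Rightarrow> 'k linf set \<Rightarrow> 'k linf set" where
  "quot_scale M c P = linf_scale c ` P + M"

definition quot_norm :: "'k::real_normed_field linf set \<Rightarrow> real" where
  "quot_norm P = infdist 0 P"

definition quot_dist ::
    "'k::real_normed_field linf set \<Rightarrow> 'k linf set \<Rightarrow> 'k linf set \<Rightarrow> real" where
  "quot_dist M P Q = quot_norm (P + quot_scale M (-1) Q)"

definition quot_topology ::
    "'k::real_normed_field linf set \<Rightarrow> 'k linf set topology" where
  "quot_topology M = Metric_space.mtopology (quot M) (quot_dist M)"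

definition quot_isomorphic_to_subspace_linf ::
    "'k::real_normed_field linf set \<Rightarrow> bool" where
  "quot_isomorphic_to_subspace_linf M \<longleftrightarrow>
     (\<exists>(T :: 'k linf set \<Rightarrow> 'k linf) E.
        linf.subspace E \<and> closed E \<and>
        (\<forall>P\<in>quot M. \<forall>Q\<in>quot M. T (P + Q) = T P + T Q) \<and>
        (\<forall>c. \<forall>P\<in>quot M. T (quot_scale M c P) = linf_scale c (T P)) \<and>
        homeomorphic_map (quot_topology M) (top_of_set E) T)"

definition complemented_linf :: "'k::real_normed_field linf set \<Rightarrow> bool" where
  "complemented_linf E \<longleftrightarrow>
     (\<exists>F. linf.subspace F \<and> closed F \<and> E \<inter> F = {0} \<and> E + F = UNIV)"


text \<open>
  The quotient operations are the expected ones on representatives, the distance is a metric,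
  and \<open>c0_ideal I\<close> is a closed subspace.
\<close>

lemma linf_scale_minus_one [simp]: "linf_scale (-1) x = - x"
  by (rule bcontfun_eqI) simp

lemma subspace_plus_self:
  assumes "linf.subspace M"
  shows "M + M = M"
proof -
  have "x \<in> M + M" if "x \<in> M" for x
    using set_plus_intro[OF that linf.subspace_0[OF assms]] by simp
  then show ?thesis
    using linf.subspace_add[OF assms] by (auto elim!: set_plus_elim)
qed

lemma quot_add:
  assumes "linf.subspace M"
  shows "(x +o M) + (y +o M) = (x + y) +o M"
  by (simp add: set_plus_rearrange subspace_plus_self[OF assms])

lemma quot_scale:
  assumes "linf.subspace M"
  shows "quot_scale M c (x +o M) = linf_scale c x +o M"
proof -
  have coset: "y +o N = (+) y ` N" for y and N :: "'a linf set"
    by (auto simp: elt_set_plus_def)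
  have "linf_scale c ` (x +o M) = linf_scale c x +o linf_scale c ` M"
    by (simp add: coset image_image linf.scale_right_distrib)
  moreover have "linf_scale c ` M + M = M"
  proof
    show "linf_scale c ` M + M \<subseteq> M"
      using linf.subspace_add[OF assms] linf.subspace_scale[OF assms]
      by (auto elim!: set_plus_elim)
    show "M \<subseteq> linf_scale c ` M + M"
    proof
      fix m assume "m \<in> M"
      moreover have "0 \<in> linf_scale c ` M"
        using linf.subspace_0[OF assms] by (auto intro!: image_eqI[of _ _ 0])
      ultimately have "0 + m \<in> linf_scale c ` M + M" by (rule set_plus_intro[rotated])
      then show "m \<in> linf_scale c ` M + M" by simp
    qed
  qed
  ultimately show ?thesis
    by (simp add: quot_scale_def set_plus_rearrange3)
qed

lemma quot_norm_coset:
  assumes "linf.subspace M"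
  shows "quot_norm (x +o M) = (INF m\<in>M. norm (x + m))"
proof -
  have "x +o M = (\<lambda>m. x + m) ` M" by (auto simp: elt_set_plus_def)
  then show ?thesis
    using linf.subspace_0[OF assms] by (auto simp: quot_norm_def infdist_def image_image)
qed

lemma quot_norm_coset_infdist:
  assumes "linf.subspace M"
  shows "quot_norm (x +o M) = infdist x M"
proof -
  have "(\<lambda>m. norm (x + m)) ` M = dist x ` M"
  proof (intro equalityI subsetI)
    fix r assume "r \<in> (\<lambda>m. norm (x + m)) ` M"
    then obtain m where "m \<in> M" "r = norm (x + m)" by auto
    then show "r \<in> dist x ` M"
      using linf.subspace_neg[OF assms] by (intro image_eqI[of _ _ "-m"]) (auto simp: dist_norm)
  next
    fix r assume "r \<in> dist x ` M"
    then obtain m where "m \<in> M" "r = norm (x + - m)" by (auto simp: dist_norm)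
    then show "r \<in> (\<lambda>m. norm (x + m)) ` M"
      using linf.subspace_neg[OF assms] by (intro image_eqI[of _ _ "-m"]) auto
  qed
  then show ?thesis
    using linf.subspace_0[OF assms] quot_norm_coset[OF assms, of x] by (auto simp: infdist_def)
qed

lemma quot_dist_coset:
  assumes "linf.subspace M"
  shows "quot_dist M (x +o M) (y +o M) = infdist (x - y) M"
  by (simp add: quot_dist_def quot_scale[OF assms] quot_add[OF assms] quot_norm_coset_infdist[OF assms])

lemma infdist_subspace_add:
  assumes "linf.subspace M"
  shows "infdist (x + y) M \<le> infdist x M + infdist y M"
proof (rule field_le_epsilon)
  fix e :: real assume "e > 0"
  have ne: "M \<noteq> {}" using linf.subspace_0[OF assms] by auto
  obtain a where a: "a \<in> M" "dist x a < infdist x M + e / 2"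
    using cInf_lessD[of "dist x ` M" "infdist x M + e / 2"] ne \<open>e > 0\<close>
    by (auto simp: infdist_def)
  obtain b where b: "b \<in> M" "dist y b < infdist y M + e / 2"
    using cInf_lessD[of "dist y ` M" "infdist y M + e / 2"] ne \<open>e > 0\<close>
    by (auto simp: infdist_def)
  have "infdist (x + y) M \<le> dist (x + y) (a + b)"
    by (intro infdist_le linf.subspace_add[OF assms] a b)
  also have "\<dots> \<le> dist x a + dist y b" by (rule dist_triangle_add)
  finally show "infdist (x + y) M \<le> infdist x M + infdist y M + e" using a b by simp
qed

lemma Metric_space_quot:
  assumes "linf.subspace M" "closed M"
  shows "Metric_space (quot M) (quot_dist M)"
proof
  have ne: "M \<noteq> {}" using linf.subspace_0[OF assms(1)] by auto
  have neg: "uminus ` M = M"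
    using linf.subspace_neg[OF assms(1)] by (force intro: image_eqI[of _ _ "- _"])
  fix P Q
  show "0 \<le> quot_dist M P Q"
    by (simp add: quot_dist_def quot_norm_def infdist_nonneg)
  have le: "infdist 0 (uminus ` S) = infdist 0 S" for S :: "'a linf set"
    by (simp add: infdist_def image_image)
  have "uminus ` (P + quot_scale M (- 1) Q) = uminus ` P + (Q + uminus ` M)"
    by (force simp: quot_scale_def set_plus_def)
  also have "\<dots> = Q + quot_scale M (- 1) P"
    by (simp add: neg quot_scale_def ac_simps)
  finally show "quot_dist M P Q = quot_dist M Q P"
    unfolding quot_dist_def quot_norm_def using le by metis
next
  fix P Q assume "P \<in> quot M" "Q \<in> quot M"
  then obtain x y where xy: "P = x +o M" "Q = y +o M" by (auto simp: quot_def)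
  have "infdist (x - y) M = 0 \<longleftrightarrow> x - y \<in> M"
    using in_closed_iff_infdist_zero[OF assms(2)] linf.subspace_0[OF assms(1)] by blast
  also have "\<dots> \<longleftrightarrow> P = Q"
  proof
    assume "x - y \<in> M"
    then have "(x - y) +o M = M"
      using quot_add[OF assms(1), of "x - y" 0] linf.subspace_add[OF assms(1)]
        linf.subspace_diff[OF assms(1)]
      by (auto simp: elt_set_plus_def) (metis add_diff_cancel_left' diff_add_cancel)
    then show "P = Q"
      using set_plus_rearrange2[of y "x - y" M] by (simp add: xy)
  next
    assume "P = Q"
    then have "x \<in> y +o M"
      using linf.subspace_0[OF assms(1)] by (force simp: xy elt_set_plus_def)
    then show "x - y \<in> M" by (rule set_plus_imp_minus)
  qed
  finally show "quot_dist M P Q = 0 \<longleftrightarrow> P = Q"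
    by (simp add: xy quot_dist_coset[OF assms(1)])
next
  fix P Q R assume "P \<in> quot M" "Q \<in> quot M" "R \<in> quot M"
  then obtain x y z where "P = x +o M" "Q = y +o M" "R = z +o M" by (auto simp: quot_def)
  then show "quot_dist M P R \<le> quot_dist M P Q + quot_dist M Q R"
    using infdist_subspace_add[OF assms(1), of "x - y" "y - z"]
    by (simp add: quot_dist_coset[OF assms(1)])
qed

lemma null_along_add:
  assumes "set_ideal I" "null_along I x" "null_along I y"
  shows "null_along I (\<lambda>n. x n + y n)"
  unfolding null_along_def
proof (intro allI impI)
  fix e :: real assume "e > 0"
  then obtain A B where AB: "A \<in> I" "B \<in> I"
    "\<And>n. n \<notin> A \<Longrightarrow> norm (x n) < e / 2" "\<And>n. n \<notin> B \<Longrightarrow> norm (y n) < e / 2"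
    using assms(2,3) unfolding null_along_def by (meson half_gt_zero)
  have "\<Union>{A, B} \<in> I" using assms(1) AB unfolding set_ideal_def
    by (metis empty_subsetI finite.emptyI finite.insertI insert_subset)
  moreover have "norm (x n + y n) < e" if "n \<notin> \<Union>{A, B}" for n
    using AB(3)[of n] AB(4)[of n] that norm_triangle_ineq[of "x n" "y n"] by auto
  ultimately show "\<exists>A\<in>I. \<forall>n. n \<notin> A \<longrightarrow> norm (x n + y n) < e" by blast
qed

lemma null_along_mult:
  fixes x :: "nat \<Rightarrow> 'k::real_normed_field"
  assumes "null_along I x"
  shows "null_along I (\<lambda>n. c * x n)"
  unfolding null_along_def
proof (intro allI impI)
  fix e :: real assume "e > 0"
  then have "e / (norm c + 1) > 0" by (simp add: add_nonneg_pos)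
  then obtain A where A: "A \<in> I" "\<And>n. n \<notin> A \<Longrightarrow> norm (x n) < e / (norm c + 1)"
    using assms unfolding null_along_def by meson
  have "norm (c * x n) < e" if "n \<notin> A" for n
  proof -
    have "norm (c * x n) \<le> (norm c + 1) * norm (x n)"
      by (simp add: norm_mult algebra_simps)
    also have "\<dots> < e"
      using A(2)[OF that] by (simp add: pos_less_divide_eq add_nonneg_pos mult.commute)
    finally show ?thesis .
  qed
  then show "\<exists>A\<in>I. \<forall>n. n \<notin> A \<longrightarrow> norm (c * x n) < e" using A(1) by blast
qed

lemma subspace_c0_ideal:
  assumes "set_ideal I"
  shows "linf.subspace (c0_ideal I)"
proof (rule linf.subspaceI)
  have "\<Union>{} \<in> I" using assms unfolding set_ideal_def by (metis empty_subsetI finite.emptyI)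
  then show "0 \<in> c0_ideal I" by (auto simp: c0_ideal_def null_along_def)
qed (simp_all add: c0_ideal_def null_along_add[OF assms] null_along_mult
    apply_bcontfun_linf_scale)

lemma closed_c0_ideal: "closed (c0_ideal I)"
  unfolding closed_sequential_limits
proof (intro allI impI, elim conjE)
  fix f :: "nat \<Rightarrow> 'a linf" and x
  assume f: "\<forall>n. f n \<in> c0_ideal I" and lim: "f \<longlonglongrightarrow> x"
  have "\<exists>A\<in>I. \<forall>n. n \<notin> A \<longrightarrow> norm (apply_bcontfun x n) < e" if "e > 0" for e
  proof -
    obtain k where k: "dist (f k) x < e / 2"
      using lim \<open>e > 0\<close> unfolding lim_sequentially by (meson half_gt_zero order_refl)
    obtain A where A: "A \<in> I" "\<And>n. n \<notin> A \<Longrightarrow> norm (apply_bcontfun (f k) n) < e / 2"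
    proof -
      have "null_along I (apply_bcontfun (f k))" using f by (simp add: c0_ideal_def)
      moreover have "e / 2 > 0" using \<open>e > 0\<close> by simp
      ultimately show ?thesis using that unfolding null_along_def by blast
    qed
    have "norm (apply_bcontfun x n) < e" if "n \<notin> A" for n
      using A(2)[OF that] k dist_bounded[of "f k" n x]
        norm_triangle_sub[of "apply_bcontfun x n" "apply_bcontfun (f k) n"]
      unfolding dist_norm by (smt (verit) field_sum_of_halves norm_minus_commute)
    then show ?thesis using A(1) by blast
  qed
  then show "x \<in> c0_ideal I" by (simp add: c0_ideal_def null_along_def)
qed

end

theory Submission
  imports Defs
begin

text \<open>
  Let \<open>S\<close> be a bounded operator on \<open>\<ell>\<^sub>\<infinity>\<close> with kernel \<open>c0_ideal I\<close>. For \<open>A \<notin> I\<close> the image under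
  \<open>S\<close> of the indicator of \<open>A\<close> is nonzero, so if the almost disjoint family is uncountable, then
  for some coordinate \<open>n\<close> and some \<open>\<delta> > 0\<close> infinitely many of these images exceed \<open>\<delta>\<close> in modulus
  at \<open>n\<close>. A sum of \<open>N\<close> such indicators with unimodular coefficients differs from an element of
  the unit ball by an element of \<open>c0_ideal I\<close>, but for the right coefficients its image exceeds
  \<open>N\<delta>\<close> at \<open>n\<close>. An embedding of the quotient yields such an \<open>S\<close> by composition with the quotient
  map; a complement yields one as the projection along \<open>c0_ideal I\<close>, which is bounded by the
  closed graph theorem.
\<close>

section \<open>The closed graph theorem\<close>

text \<open>The sets where \<open>norm (L x)\<close> is at most \<open>n\<close> cover the space, so
  by Baire the closure of one of them contains a ball; moving it to the origin and rescaling gives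
  the bound.\<close>

lemma linear_approx_bounded_preimage:
  fixes L :: "'a::banach \<Rightarrow> 'b::real_normed_vector"
  assumes "linear L"
  obtains B where "B \<ge> 0"
    "\<And>x e. e > 0 \<Longrightarrow> \<exists>v. norm (L v) \<le> B * norm x \<and> norm (x - v) < e"
proof -
  define V where "V = (\<lambda>n::nat. {x. norm (L x) \<le> real n})"
  have un: "(\<Union>n. closure (V n)) = UNIV"
  proof -
    have "\<exists>n. x \<in> closure (V n)" for x
      using real_arch_simple[of "norm (L x)"] closure_subset by (fastforce simp: V_def)
    then show ?thesis by blast
  qed
  have "\<exists>n. interior (closure (V n)) \<noteq> {}"
  proof (rule ccontr)
    assume "\<not> ?thesis"
    then have "euclidean interior_of \<Union>(range (\<lambda>n. closure (V n))) = {}"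
      by (intro Baire_category_alt disjI1 completely_metrizable_space_euclidean) auto
    then show False by (simp add: un)
  qed
  then obtain n x0 where "x0 \<in> interior (closure (V n))" by auto
  then obtain r where r: "r > 0" "ball x0 r \<subseteq> closure (V n)"
    using mem_interior by blast
  \<comment> \<open>Differences of elements of \<open>V n\<close> near \<open>x0 + y\<close> and
    near \<open>x0\<close> approximate \<open>y\<close>: the ball moves to the origin and the bound
    doubles.\<close>
  have ball: "\<exists>v. norm (L v) \<le> 2 * real n \<and> norm (y - v) < e" if "norm y < r" "e > 0" for y e
  proof -
    have "x0 + y \<in> closure (V n)" "x0 \<in> closure (V n)"
      using that r by (auto simp: dist_norm subset_iff)
    moreover have "e / 2 > 0" using that by simp
    ultimately obtain a b where ab: "a \<in> V n" "dist a (x0 + y) < e / 2" "b \<in> V n" "dist b x0 < e / 2"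
      unfolding closure_approachable by meson
    have "norm (L (a - b)) \<le> 2 * real n"
      using ab(1,3) norm_triangle_ineq4[of "L a" "L b"]
      by (simp add: V_def linear_diff[OF assms])
    moreover have "norm (y - (a - b)) < e"
    proof -
      have "y - (a - b) = (b - x0) - (a - (x0 + y))" by simp
      then have "norm (y - (a - b)) \<le> dist b x0 + dist a (x0 + y)"
        unfolding dist_norm by (metis norm_triangle_ineq4)
      then show ?thesis using ab(2,4) by linarith
    qed
    ultimately show ?thesis by blast
  qed
  show thesis
  proof (rule that)
    show "4 * real n / r \<ge> 0" using r by simp
    fix x :: 'a and e :: real assume "e > 0"
    show "\<exists>v. norm (L v) \<le> 4 * real n / r * norm x \<and> norm (x - v) < e"
    proof (cases "x = 0")
      case True
      then show ?thesis using \<open>e > 0\<close> by (intro exI[of _ 0]) (simp add: linear_0[OF assms])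
    next
      case False
      \<comment> \<open>Division by \<open>t\<close> brings \<open>x\<close> to norm
        \<open>r / 2\<close>, inside the ball; the bound \<open>2 * real n\<close> times
        \<open>t\<close> gives the constant \<open>4 * real n / r\<close>.\<close>
      define t where "t = 2 * norm x / r"
      have t: "t > 0" using False r by (simp add: t_def)
      have "norm (x /\<^sub>R t) < r" using False r t by (simp add: t_def field_simps)
      then obtain v where v: "norm (L v) \<le> 2 * real n" "norm (x /\<^sub>R t - v) < e / t"
        using ball[of "x /\<^sub>R t" "e / t"] \<open>e > 0\<close> t by auto
      have "norm (L (t *\<^sub>R v)) \<le> t * (2 * real n)"
        using v(1) t by (simp add: linear_cmul[OF assms] mult_left_mono)
      moreover have "norm (x - t *\<^sub>R v) < e"
      proof -
        have "x - t *\<^sub>R v = t *\<^sub>R (x /\<^sub>R t - v)" using t by (simp add: scaleR_right_diff_distrib)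
        then have "norm (x - t *\<^sub>R v) = t * norm (x /\<^sub>R t - v)" using t by simp
        then show ?thesis using v(2) t by (simp add: pos_less_divide_eq mult.commute)
      qed
      ultimately show ?thesis
        by (intro exI[of _ "t *\<^sub>R v"]) (simp add: t_def mult_ac)
    qed
  qed
qed

text \<open>Repeated approximation writes \<open>x\<close> as a series whose terms have images
  dominated by a geometric series; closedness of the graph forces these images to sum to
  \<open>L x\<close>.\<close>

theorem closed_graph_theorem:
  fixes L :: "'a::banach \<Rightarrow> 'b::banach"
  assumes "linear L" and "closed (range (\<lambda>x. (x, L x)))"
  shows "bounded_linear L"
proof -
  obtain B where B: "B \<ge> 0"
    "\<And>x e. e > 0 \<Longrightarrow> \<exists>v. norm (L v) \<le> B * norm x \<and> norm (x - v) < e"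
    using linear_approx_bounded_preimage[OF assms(1)] by metis
  have "norm (L x) \<le> norm x * (2 * B)" for x
  proof (cases "x = 0")
    case True
    then show ?thesis by (simp add: linear_0[OF assms(1)])
  next
    case False
    \<comment> \<open>\<open>r k\<close> is the remainder after \<open>k\<close> corrections; each
      correction approximates \<open>r k\<close> with controlled image, up to an error below
      \<open>norm x / 2 ^ (k + 1)\<close>.\<close>
    have "\<exists>r. \<forall>k. (norm (r k) \<le> norm x * (1/2) ^ k \<and> (k = 0 \<longrightarrow> r k = x)) \<and>
              norm (L (r k - r (Suc k))) \<le> B * norm (r k)"
    proof (rule dependent_nat_choice)
      show "\<exists>y. norm y \<le> norm x * (1/2) ^ 0 \<and> (0 = (0::nat) \<longrightarrow> y = x)" by auto
      fix y k
      have "norm x * (1/2) ^ Suc k > 0" using False by simp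
      then obtain v where "norm (L v) \<le> B * norm y" "norm (y - v) < norm x * (1/2) ^ Suc k"
        using B(2) by blast
      then show "\<exists>z. (norm z \<le> norm x * (1/2) ^ Suc k \<and> (Suc k = 0 \<longrightarrow> z = x)) \<and>
                  norm (L (y - z)) \<le> B * norm y"
        by (intro exI[of _ "y - v"]) auto
    qed
    then obtain r where r: "\<And>k. norm (r k) \<le> norm x * (1/2) ^ k" "r 0 = x"
      "\<And>k. norm (L (r k - r (Suc k))) \<le> B * norm (r k)"
      by blast
    define u where "u = (\<lambda>k. L (r k - r (Suc k)))"
    have geo: "(\<lambda>k. B * norm x * (1/2) ^ k) sums (B * norm x * 2)"
      using sums_mult[OF geometric_sums[of "1/2::real"], of "B * norm x"] by simp
    have le: "norm (u k) \<le> B * norm x * (1/2) ^ k" for k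
      using r(3)[of k] mult_left_mono[OF r(1)[of k] B(1)] by (simp add: u_def mult.assoc)
    have sm: "summable (\<lambda>k. norm (u k))"
      using summable_comparison_test'[OF sums_summable[OF geo], of 0 "\<lambda>k. norm (u k)"] le by simp
    have "(\<lambda>n. \<Sum>k<n. u k) \<longlonglongrightarrow> suminf u"
      using summable_LIMSEQ[OF summable_norm_cancel[OF sm]] .
    moreover have "(\<Sum>k<n. u k) = L (x - r n)" for n
      by (simp add: u_def linear_sum[OF assms(1), symmetric] sum_lessThan_telescope' r(2))
    ultimately have "(\<lambda>n. L (x - r n)) \<longlonglongrightarrow> suminf u" by simp
    moreover have "r \<longlonglongrightarrow> 0"
    proof (rule Lim_null_comparison)
      show "\<forall>\<^sub>F k in sequentially. norm (r k) \<le> norm x * (1/2) ^ k" using r(1) by simp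
      show "(\<lambda>k. norm x * (1/2) ^ k) \<longlonglongrightarrow> 0"
        by (intro tendsto_mult_right_zero LIMSEQ_power_zero) simp
    qed
    then have "(\<lambda>n. x - r n) \<longlonglongrightarrow> x" using tendsto_diff[OF tendsto_const, of r 0 _ x] by simp
    ultimately have "(\<lambda>n. (x - r n, L (x - r n))) \<longlonglongrightarrow> (x, suminf u)" by (intro tendsto_Pair)
    \<comment> \<open>The closed graph identifies the limit of \<open>L (x - r n)\<close> as
      \<open>L x\<close>.\<close>
    then have "(x, suminf u) \<in> range (\<lambda>x. (x, L x))"
      by (rule closed_sequentially[OF assms(2), rotated]) (rule rangeI)
    then have "L x = suminf u" by auto
    also have "norm \<dots> \<le> (\<Sum>k. norm (u k))" by (rule summable_norm[OF sm])
    also have "\<dots> \<le> (\<Sum>k. B * norm x * (1/2) ^ k)"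
      by (rule suminf_le[OF le sm sums_summable[OF geo]])
    also have "\<dots> = norm x * (2 * B)" by (simp add: sums_unique[OF geo, symmetric])
    finally show ?thesis .
  qed
  then show ?thesis
    using assms(1) by (intro bounded_linear_intro) (auto simp: linear_add linear_cmul)
qed

section \<open>Bounded operators on bounded sequences\<close>

text \<open>The library has this only for metric domains, and \<^typ>\<open>nat\<close> is not an instance of that class.\<close>

instance bcontfun :: (topological_space, complete_space) complete_space
proof
  fix f :: "nat \<Rightarrow> ('a, 'b) bcontfun"
  assume "Cauchy f"
  have "uniformly_Cauchy_on UNIV (\<lambda>n. apply_bcontfun (f n))"
    unfolding uniformly_Cauchy_on_def
  proof (intro allI impI)
    fix e :: real assume "e > 0"
    then obtain N where "\<forall>m\<ge>N. \<forall>n\<ge>N. dist (f m) (f n) < e"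
      using \<open>Cauchy f\<close> unfolding Cauchy_def by blast
    then show "\<exists>N. \<forall>x\<in>UNIV. \<forall>m\<ge>N. \<forall>n\<ge>N. dist (apply_bcontfun (f m) x) (apply_bcontfun (f n) x) < e"
      using dist_fun_lt_imp_dist_val_lt by blast
  qed
  from Cauchy_uniformly_convergent[OF this]
  obtain g where "uniform_limit UNIV (\<lambda>n. apply_bcontfun (f n)) g sequentially"
    unfolding uniformly_convergent_on_def by blast
  then obtain l where "f \<longlonglongrightarrow> l"
    by (rule uniform_limit_bcontfunE[OF _ sequentially_bot])
  then show "convergent f" by (rule convergentI)
qed

instance bcontfun :: (topological_space, banach) banach ..

lemma bounded_seq_apply_Bcontfun:
  fixes f :: "nat \<Rightarrow> 'k::real_normed_vector"
  assumes "\<And>n. norm (f n) \<le> b"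
  shows "apply_bcontfun (Bcontfun f) = f"
  by (rule Bcontfun_inverse, rule bcontfun_normI[of _ b]) (use assms in auto)

definition linf_indicator :: "nat set \<Rightarrow> 'k::real_normed_field linf" where
  "linf_indicator A = Bcontfun (indicator A)"

lemma linf_indicator_apply [simp]: "apply_bcontfun (linf_indicator A) n = indicator A n"
  unfolding linf_indicator_def
  by (subst bounded_seq_apply_Bcontfun[of _ 1]) (auto simp: indicator_def)

text \<open>An indicator takes only the values 0 and 1, so an exceptional set for the threshold 1
  already contains \<open>A\<close>.\<close>

lemma linf_indicator_in_c0_ideal_iff:
  assumes "set_ideal I"
  shows "(linf_indicator A :: 'k::real_normed_field linf) \<in> c0_ideal I \<longleftrightarrow> A \<in> I"
proof
  assume "(linf_indicator A :: 'k linf) \<in> c0_ideal I"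
  then obtain B where B: "B \<in> I" "\<And>n. n \<notin> B \<Longrightarrow> norm (indicator A n :: 'k) < 1"
    unfolding c0_ideal_def null_along_def by (auto dest: spec[of _ 1])
  then have "A \<subseteq> B" by (force simp: indicator_def)
  then show "A \<in> I" using assms B(1) unfolding set_ideal_def by blast
next
  assume "A \<in> I"
  then show "(linf_indicator A :: 'k linf) \<in> c0_ideal I"
    by (auto simp: c0_ideal_def null_along_def intro!: bexI[of _ A])
qed

lemma linf_scaleR_eq: "r *\<^sub>R x = linf_scale (of_real r) x"
  by (rule bcontfun_eqI) (simp add: scaleR_conv_of_real)

lemma apply_bcontfun_sum: "apply_bcontfun (\<Sum>a\<in>F. f a) n = (\<Sum>a\<in>F. apply_bcontfun (f a) n)"
  by (induction F rule: infinite_finite_induct) auto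

text \<open>Outside the finite union of the pairwise intersections, which lies in \<open>I\<close>,
  at most one indicator is nonzero at each point, so the sum has modulus at most 1 there; setting it
  to 0 on that union gives \<open>y\<close>.\<close>

lemma almost_disjoint_combination_near_unit_ball:
  fixes s :: "nat set \<Rightarrow> 'k::real_normed_field"
  assumes "set_ideal I" "finite F" "\<And>A B. A \<in> F \<Longrightarrow> B \<in> F \<Longrightarrow> A \<noteq> B \<Longrightarrow> A \<inter> B \<in> I"
    and "\<And>A. A \<in> F \<Longrightarrow> norm (s A) \<le> 1"
  obtains y where "norm y \<le> 1" "(\<Sum>A\<in>F. linf_scale (s A) (linf_indicator A)) - y \<in> c0_ideal I"
proof -
  define x where "x = (\<Sum>A\<in>F. linf_scale (s A) (linf_indicator A))"
  define C where "C = \<Union>((\<lambda>(A, B). A \<inter> B) ` {(A, B) \<in> F \<times> F. A \<noteq> B})"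
  have "finite {(A, B) \<in> F \<times> F. A \<noteq> B}"
    by (rule finite_subset[of _ "F \<times> F"]) (use assms(2) in auto)
  then have C: "C \<in> I"
    using assms(1,3) unfolding set_ideal_def C_def by (auto simp: image_subset_iff)
  define g where "g = (\<lambda>n. if n \<in> C then 0 else apply_bcontfun x n)"
  have g: "norm (g n) \<le> 1" for n
  proof (cases "n \<notin> C \<and> (\<exists>A\<in>F. n \<in> A)")
    case True
    then obtain A where A: "A \<in> F" "n \<in> A" by blast
    have "apply_bcontfun x n = (\<Sum>B\<in>F. if B = A then s A else 0)"
      unfolding x_def apply_bcontfun_sum
    proof (rule sum.cong)
      fix B assume "B \<in> F"
      then have "n \<notin> B" if "B \<noteq> A" using True A that unfolding C_def by blast
      then show "apply_bcontfun (linf_scale (s B) (linf_indicator B)) n = (if B = A then s A else 0)"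
        using A by auto
    qed simp
    then show ?thesis using A assms(2,4) True by (simp add: g_def)
  next
    \<comment> \<open>Either \<open>n\<close> lies in \<open>C\<close>, where \<open>g\<close> is 0,
      or no set of \<open>F\<close> contains \<open>n\<close> and the sum vanishes.\<close>
    case False
    then show ?thesis by (auto simp: g_def x_def apply_bcontfun_sum)
  qed
  show thesis
  proof (rule that)
    show "norm (Bcontfun g) \<le> 1"
      by (rule norm_bound) (simp add: bounded_seq_apply_Bcontfun[OF g] g)
    show "(\<Sum>A\<in>F. linf_scale (s A) (linf_indicator A)) - Bcontfun g \<in> c0_ideal I"
    proof -
      have "apply_bcontfun (x - Bcontfun g) n = 0" if "n \<notin> C" for n
        using that by (simp add: bounded_seq_apply_Bcontfun[OF g]) (simp add: g_def)
      then show ?thesis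
        unfolding x_def[symmetric] c0_ideal_def null_along_def mem_Collect_eq
        by (intro allI impI bexI[OF _ C]) (simp del: minus_bcontfun.rep_eq)
    qed
  qed
qed

lemma countable_almost_disjoint_of_bounded_operator:
  fixes S :: "'k::real_normed_field linf \<Rightarrow> 'k linf"
  assumes "set_ideal I" "\<A> \<inter> I = {}"
    and disj: "\<And>A B. A \<in> \<A> \<Longrightarrow> B \<in> \<A> \<Longrightarrow> A \<noteq> B \<Longrightarrow> A \<inter> B \<in> I"
    and lin: "Vector_Spaces.linear linf_scale linf_scale S"
    and ker: "\<And>x. S x = 0 \<longleftrightarrow> x \<in> c0_ideal I"
    and bdd: "\<And>x. norm x \<le> 1 \<Longrightarrow> norm (S x) \<le> C"
  shows "countable \<A>"
proof (rule ccontr)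
  assume "uncountable \<A>"
  interpret S: Vector_Spaces.linear linf_scale linf_scale S by (rule lin)
  define v where "v = (\<lambda>A n. apply_bcontfun (S (linf_indicator A)) n)"
  \<comment> \<open>There are countably many pairs \<open>(n, k)\<close>, so if \<A> is uncountable,
    one of these sets is uncountable too.\<close>
  define \<B> where "\<B> = (\<lambda>(n, k). {A \<in> \<A>. norm (v A n) > inverse (real (Suc k))})"
  have "\<A> \<subseteq> (\<Union>p. \<B> p)"
  proof
    fix A assume "A \<in> \<A>"
    then have "S (linf_indicator A) \<noteq> 0"
      using assms(2) ker linf_indicator_in_c0_ideal_iff[OF assms(1)] by blast
    then obtain n where "v A n \<noteq> 0"
      unfolding v_def using bcontfun_eqI[of "S (linf_indicator A)" 0] by auto
    then obtain k where "inverse (real (Suc k)) < norm (v A n)"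
      using reals_Archimedean[of "norm (v A n)"] by auto
    then have "A \<in> \<B> (n, k)" using \<open>A \<in> \<A>\<close> by (simp add: \<B>_def)
    then show "A \<in> (\<Union>p. \<B> p)" by blast
  qed
  then obtain p where "uncountable (\<B> p)"
    using \<open>uncountable \<A>\<close> countable_subset countable_UN[OF countableI_type, of UNIV \<B>] by blast
  then obtain n k where inf: "infinite (\<B> (n, k))"
    using countable_finite by (metis surj_pair)
  define d where "d = inverse (real (Suc k))"
  have d: "d > 0" "\<And>A. A \<in> \<B> (n, k) \<Longrightarrow> A \<in> \<A> \<and> norm (v A n) > d"
    by (auto simp: d_def \<B>_def)
  obtain N :: nat where N: "C < real N * d"
    using ex_less_of_nat_mult[OF d(1)] by blast
  obtain F where F: "F \<subseteq> \<B> (n, k)" "finite F" "card F = N"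
    using infinite_arbitrarily_large[OF inf] by blast
  \<comment> \<open>The factor turns \<open>v A n\<close> into its modulus, so nothing cancels in
    coordinate \<open>n\<close>. If \<open>v A n = 0\<close>, division yields 0, so
    \<open>norm (s A) \<le> 1\<close> holds for every \<open>A\<close>.\<close>
  define s where "s = (\<lambda>A. of_real (norm (v A n)) / v A n)"
  define x where "x = (\<Sum>A\<in>F. linf_scale (s A) (linf_indicator A))"
  obtain y where y: "norm y \<le> 1" "x - y \<in> c0_ideal I"
  proof (rule almost_disjoint_combination_near_unit_ball[OF assms(1) F(2), of s])
    show "A \<inter> B \<in> I" if "A \<in> F" "B \<in> F" "A \<noteq> B" for A B
      using that F(1) d(2) disj by (meson subsetD)
    show "norm (s A) \<le> 1" for A by (simp add: s_def norm_divide)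
  qed (use that x_def in auto)
  \<comment> \<open>The large value in coordinate \<open>n\<close> is thus attained by the image of
    \<open>y\<close>, which lies in the unit ball.\<close>
  have "S x = S y"
    using ker[of "x - y"] y(2) by (simp add: S.diff)
  have "apply_bcontfun (S x) n = (\<Sum>A\<in>F. s A * v A n)"
    by (simp add: x_def S.sum S.scale apply_bcontfun_sum v_def)
  also have "\<dots> = of_real (\<Sum>A\<in>F. norm (v A n))"
    unfolding of_real_sum by (rule sum.cong) (simp_all add: s_def)
  finally have "norm (apply_bcontfun (S x) n) = (\<Sum>A\<in>F. norm (v A n))"
    by (simp add: sum_nonneg del: of_real_sum)
  moreover have "real N * d \<le> (\<Sum>A\<in>F. norm (v A n))"
    using sum_bounded_below[of F d "\<lambda>A. norm (v A n)"] d(2) F by (force intro: less_imp_le)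
  moreover have "norm (apply_bcontfun (S x) n) \<le> C"
    using norm_bounded[of "S y" n] bdd[OF y(1)] by (simp add: \<open>S x = S y\<close>)
  ultimately show False using N by simp
qed

section \<open>Embeddings of the quotient and complements\<close>

text \<open>The embedding is composed with the quotient map: injectivity gives the kernel,
  continuity at the zero coset the bound.\<close>

lemma bounded_operator_of_quot_embedding:
  fixes M :: "'k::real_normed_field linf set"
  assumes M: "linf.subspace M" "closed M" and "quot_isomorphic_to_subspace_linf M"
  obtains S :: "'k linf \<Rightarrow> 'k linf" and C where "Vector_Spaces.linear linf_scale linf_scale S"
    "\<And>x. S x = 0 \<longleftrightarrow> x \<in> M" "\<And>x. norm x \<le> 1 \<Longrightarrow> norm (S x) \<le> C"
proof -
  obtain T :: "'k linf set \<Rightarrow> 'k linf" and E where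
    add: "\<And>P Q. P \<in> quot M \<Longrightarrow> Q \<in> quot M \<Longrightarrow> T (P + Q) = T P + T Q" and
    scale: "\<And>c P. P \<in> quot M \<Longrightarrow> T (quot_scale M c P) = linf_scale c (T P)" and
    homeo: "homeomorphic_map (quot_topology M) (top_of_set E) T"
    using assms(3) unfolding quot_isomorphic_to_subspace_linf_def by blast
  interpret Q: Metric_space "quot M" "quot_dist M" by (rule Metric_space_quot[OF M])
  have coset: "x +o M \<in> quot M" for x by (simp add: quot_def)
  define S where "S = (\<lambda>x. T (x +o M))"
  have "Vector_Spaces.linear linf_scale linf_scale S"
    unfolding Vector_Spaces.linear_iff
    by (auto simp: S_def quot_add[OF M(1), symmetric] quot_scale[OF M(1), symmetric] add scale coset
        linf.vector_space_axioms)
  then interpret S: Vector_Spaces.linear linf_scale linf_scale S .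
  have zero: "x +o M = 0 +o M \<longleftrightarrow> x \<in> M" for x
  proof -
    have "M \<noteq> {}" using linf.subspace_0[OF M(1)] by (metis empty_iff)
    have "x +o M = 0 +o M \<longleftrightarrow> infdist (x - 0) M = 0"
      using Q.zero[OF coset coset] by (simp only: quot_dist_coset[OF M(1)])
    also have "\<dots> \<longleftrightarrow> x \<in> M"
      unfolding diff_0_right by (rule in_closed_iff_infdist_zero[OF M(2) \<open>M \<noteq> {}\<close>, symmetric])
    finally show ?thesis .
  qed
  have ker: "S x = 0 \<longleftrightarrow> x \<in> M" for x
  proof -
    have "inj_on T (quot M)"
      using homeomorphic_imp_injective_map[OF homeo] by (simp add: quot_topology_def)
    then have "T (x +o M) = T (0 +o M) \<longleftrightarrow> x +o M = 0 +o M"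
      using inj_on_eq_iff[OF _ coset coset] by metis
    moreover have "T (0 +o M) = 0" using S.zero by (simp add: S_def)
    ultimately show ?thesis using zero by (simp add: S_def)
  qed
  have "continuous_map Q.mtopology euclidean T"
    using homeomorphic_imp_continuous_map[OF homeo]
    by (simp add: quot_topology_def continuous_map_in_subtopology)
  then have "continuous_map Q.mtopology Met_TC.mtopology T" by simp
  then obtain \<delta> where \<delta>: "\<delta> > 0"
    "\<And>P. P \<in> quot M \<Longrightarrow> quot_dist M (0 +o M) P < \<delta> \<Longrightarrow> dist (T (0 +o M)) (T P) < 1"
    using Q.metric_continuous_map[OF Met_TC.Metric_space_axioms] coset zero_less_one by (metis UNIV_I)
  \<comment> \<open>Scaled by \<open>\<delta> / 2\<close>, the vector \<open>x\<close> has its coset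
    within \<delta> of the zero coset, so its image has norm below 1; linearity undoes the
    scaling.\<close>
  have "norm (S x) \<le> 2 / \<delta>" if "norm x \<le> 1" for x
  proof -
    have "infdist (0 - (\<delta> / 2) *\<^sub>R x) M \<le> norm ((\<delta> / 2) *\<^sub>R x)"
      using infdist_le[OF linf.subspace_0[OF M(1)], of "0 - (\<delta> / 2) *\<^sub>R x"] by (simp add: dist_norm)
    also have "\<dots> < \<delta>" using \<delta>(1) that by (simp add: field_simps)
    finally have "dist (S 0) (S ((\<delta> / 2) *\<^sub>R x)) < 1"
      unfolding S_def by (intro \<delta>(2) coset) (simp only: quot_dist_coset[OF M(1)])
    then have "norm ((\<delta> / 2) *\<^sub>R S x) < 1"
      by (simp add: linf_scaleR_eq S.scale S.zero del: norm_scaleR)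
    then show ?thesis using \<delta>(1) by (simp add: field_simps)
  qed
  then show thesis by (rule that[OF S.linear_axioms ker])
qed

text \<open>\<open>S\<close> is the projection onto the complement along \<open>M\<close>; its graph
  is closed because both summands are.\<close>

lemma bounded_operator_of_complement:
  fixes M :: "'k::{real_normed_field, banach} linf set"
  assumes M: "linf.subspace M" "closed M" and "complemented_linf M"
  obtains S :: "'k linf \<Rightarrow> 'k linf" and C where "Vector_Spaces.linear linf_scale linf_scale S"
    "\<And>x. S x = 0 \<longleftrightarrow> x \<in> M" "\<And>x. norm x \<le> 1 \<Longrightarrow> norm (S x) \<le> C"
proof -
  obtain F where F: "linf.subspace F" "closed F" "M \<inter> F = {0}" "M + F = UNIV"
    using assms(3) unfolding complemented_linf_def by blast
  have "\<exists>f. f \<in> F \<and> x - f \<in> M" for x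
  proof -
    have "x \<in> M + F" using F(4) by simp
    then show ?thesis by (auto elim!: set_plus_elim intro: exI[rotated])
  qed
  then obtain S where S: "\<And>x. S x \<in> F" "\<And>x. x - S x \<in> M" by metis
  \<comment> \<open>Uniqueness of the decomposition, from which additivity, homogeneity, the kernel
    and the graph of \<open>S\<close> are read off.\<close>
  have uniq: "S x = f" if "f \<in> F" "x - f \<in> M" for x f
  proof -
    have "S x - f \<in> F" using F(1) S(1) that(1) by (rule linf.subspace_diff)
    moreover have "S x - f = (x - f) - (x - S x)" by simp
    then have "S x - f \<in> M" using linf.subspace_diff[OF M(1) that(2) S(2)[of x]] by simp
    ultimately have "S x - f \<in> M \<inter> F" by (rule IntI[rotated])
    then show ?thesis unfolding F(3) by simp
  qed
  have S_add: "S (x + y) = S x + S y" for x y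
  proof (rule uniq)
    show "x + y - (S x + S y) \<in> M"
      using linf.subspace_add[OF M(1) S(2)[of x] S(2)[of y]] by (simp add: algebra_simps)
  qed (intro linf.subspace_add[OF F(1)] S)
  have S_scale: "S (linf_scale c x) = linf_scale c (S x)" for c x
  proof (rule uniq)
    show "linf_scale c x - linf_scale c (S x) \<in> M"
      using linf.subspace_scale[OF M(1) S(2)[of x]] by (simp add: linf.scale_right_diff_distrib)
  qed (intro linf.subspace_scale[OF F(1)] S)
  have lin: "Vector_Spaces.linear linf_scale linf_scale S"
    unfolding Vector_Spaces.linear_iff by (simp add: S_add S_scale linf.vector_space_axioms)
  have ker: "S x = 0 \<longleftrightarrow> x \<in> M" for x
    using S(2)[of x] uniq[of 0 x] linf.subspace_0[OF F(1)] by auto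
  \<comment> \<open>This is the graph of \<open>S\<close> described without \<open>S\<close>, by
    preimages of closed sets under continuous maps.\<close>
  have "closed {p. fst p - snd p \<in> M \<and> snd p \<in> F}"
    using continuous_closed_vimage[OF M(2), of "\<lambda>p. fst p - snd p"]
      continuous_closed_vimage[OF F(2), of snd]
    by (auto simp: vimage_def intro!: closed_Collect_conj continuous_intros)
  moreover have "{p. fst p - snd p \<in> M \<and> snd p \<in> F} = range (\<lambda>x. (x, S x))"
    using S uniq by (auto simp: image_iff)
  ultimately have cl: "closed (range (\<lambda>x. (x, S x)))" by simp
  \<comment> \<open>The closed graph theorem concerns real-linear maps; real scalars act through
    \<open>of_real\<close>.\<close>
  have "linear S"
    by (rule linearI) (simp_all only: S_add S_scale linf_scaleR_eq)
  then have "bounded_linear S" using cl by (rule closed_graph_theorem)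
  then obtain C where C: "\<And>x. norm (S x) \<le> norm x * C" "C \<ge> 0"
    using bounded_linear.nonneg_bounded by blast
  have "norm (S x) \<le> C" if "norm x \<le> 1" for x
    using C(1)[of x] mult_right_mono[OF that C(2)] by simp
  then show thesis by (rule that[OF lin ker])
qed

theorem theoremA:
  fixes I :: "nat set set"
  assumes "set_ideal I"
    and "\<exists>\<A>. uncountable \<A> \<and> \<A> \<subseteq> Pow UNIV - I \<and>
           (\<forall>A\<in>\<A>. \<forall>B\<in>\<A>. A \<noteq> B \<longrightarrow> A \<inter> B \<in> I)"
  shows "\<not> quot_isomorphic_to_subspace_linf
             (c0_ideal I :: 'k::{real_normed_field, banach} linf set) \<and>
         \<not> complemented_linf (c0_ideal I :: 'k linf set)"
proof -
  from assms(2) obtain \<A> where \<A>: "uncountable \<A>" "\<A> \<subseteq> Pow UNIV - I"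
    "\<forall>A\<in>\<A>. \<forall>B\<in>\<A>. A \<noteq> B \<longrightarrow> A \<inter> B \<in> I"
    by (elim exE conjE)
  have disj: "\<A> \<inter> I = {}" using \<A>(2) by blast
  note M = subspace_c0_ideal[OF assms(1), where 'a='k] closed_c0_ideal[of I, where 'a='k]
  have no_operator: False
    if "Vector_Spaces.linear linf_scale linf_scale S" "\<And>x. S x = 0 \<longleftrightarrow> x \<in> c0_ideal I"
      "\<And>x. norm x \<le> 1 \<Longrightarrow> norm (S x) \<le> C" for S :: "'k linf \<Rightarrow> 'k linf" and C
    using countable_almost_disjoint_of_bounded_operator[OF assms(1) disj \<A>(3)[rule_format] that]
      \<A>(1)
    by contradiction
  show ?thesis
  proof (intro conjI notI)
    assume "quot_isomorphic_to_subspace_linf (c0_ideal I :: 'k linf set)"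
    then show False by (rule bounded_operator_of_quot_embedding[OF M]) (rule no_operator)
  next
    assume "complemented_linf (c0_ideal I :: 'k linf set)"
    then show False by (rule bounded_operator_of_complement[OF M]) (rule no_operator)
  qed
qed

end
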